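(* For every $n\ge1$, use for $L(3,n)$ the Sperner chain decomposition given by the map $\varphi$ (defined in the context). Then Algorithm RecUD (described in the context), applied recursively in $n$, succeeds and gives rise to a Sperner chain decomposition of $L(4,n)$ whose set of starting partitions is $$S_{4,n}=\{(6k+s+\ell,\,4k+\ell,\,2k,\,0):\ s,\ell,k\ge0,\ s\ne1,\ \ell\ne1,\ 6k+s+\ell\le n\}.$$
   Context: $L(m,n)$ is the poset of integer vectors $\lambda=(\lambda_1,\dots,\lambda_m)$ with $n\ge\lambda_1\ge\cdots\ge\lambda_m\ge0$, ordered componentwise, with rank $|\lambda|=\sum\lambda_i$ and dual $\lambda^*=(n-\lambda_m,\dots,n-\lambda_1)$. A chain decomposition (partition into disjoint chains) of $L(m,n)$ is Sperner if each chain $x_{1}<\cdots<x_{e}$ satisfies $|x_1|\le mn/2\le|x_e|$ and contains an element of rank $\lfloor mn/2\rfloor$; the elements $x_1$ are the starting partitions, the $x_e$ the end partitions. Let $d_{m,n}=\lfloor (mn+1)/2\rfloor$ and $L^U(m,n)=\{\lambda\in L(m,n):|\lambda|\le d_{m,n}\}$. A U-decomposition of $L^U(m,n)$ is a partition of it into disjoint chains, each of whose top elements has rank $d_{m,n}$. Kneading: given a U-decomposition $\{C_i\}$ of $L^U(4,n)$ (so $d_{4,n}=2n$), the duals $C_i^*$ (elementwise duals, order reversed) decompose the elements of rank $\ge 2n$, and the top elements of the $C_i$ are exactly the bottom elements of the $C_i^*$; gluing each $C_i$ with the $C_{i'}^*$ whose bottom is the top of $C_i$ yields a Sperner chain decomposition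 of $L(4,n)$ with the same starting partitions as $\{C_i\}$; its end partitions are the duals of its starting partitions. Decomposition of $L(3,n)$: let $\mathbb N=\{0,1,2,\dots\}$. For integers $n\ge0$ put $S_{3,n}=\{(4k+\ell,2k,0):k\in\mathbb N,\ \ell\in\mathbb N\setminus\{1\},\ 4k+\ell\le n,\ 6k+\ell\le 3n/2\}$ and $E_{3,n}=\{\lambda^*:\lambda\in S_{3,n}\}$ (dual in $L(3,n)$); a triple that is not a partition is in no $E_{3,p}$. Define $\varphi:L(3,n)\setminus E_{3,n}\to L(3,n)\setminus S_{3,n}$ by: if $\lambda\in E_{3,\lambda_1}$ then $\varphi(\lambda)=(\lambda_1+1,\lambda_2,\lambda_3)$; otherwise $\varphi(\lambda)=(\lambda_1,\lambda_2+1,\lambda_3)$ if $\lambda_2+\lambda_3$ is even and $(\lambda_1-1,\lambda_2+1,\lambda_3)\notin E_{3,\lambda_1-1}$, or if $\lambda_2+\lambda_3$ is odd and $(\lambda_1-1,\lambda_2,\lambda_3+1)\in E_{3,\lambda_1-1}$; and $\varphi(\lambda)=(\lambda_1,\lambda_2,\lambda_3+1)$ if $\lambda_2+\lambda_3$ is odd and $(\lambda_1-1,\lambda_2,\lambda_3+1)\notin E_{3,\lambda_1-1}$. This $\varphi$ is a bijection, and the chains $\mu\lessdot\varphi(\mu)\lessdot\varphi^2(\mu)\lessdot\cdots$ with $\mu\in S_{3,n}$, each ending in $E_{3,n}$, form a Sperner chain decomposition of $L(3,n)$; truncating them to ranks $\le d_{3,n}$ gives the U-decomposition of $L^U(3,n)$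 that is used. Algorithm RecUD (for $m=4$, $n\ge2$; based on $L(4,n)=L(4,n-1)\uplus(n\oplus L(3,n))$ where $n\oplus(\lambda_1,\lambda_2,\lambda_3)=(n,\lambda_1,\lambda_2,\lambda_3)$). Input: U-decompositions of $L^U(4,n-1)$ and $L^U(3,n)$. (1) Knead the first into a Sperner chain decomposition of $L(4,n-1)$. Chains ending at rank less than $d_{4,n}$ are bad; the other chains are truncated to ranks $\le d_{4,n}$ and called good. Let $\alpha^1,\dots,\alpha^e$ be the end partitions of the bad chains. (2) Apply $\lambda\mapsto n\oplus\lambda$ to the chains of the U-decomposition of $L^U(3,n)$ and truncate to ranks $\le d_{4,n}$ (discarding chains that become empty); these are the candidate chains, and let $S$ be the set of their starting partitions. (3) For each $\alpha^i$ add $1$ to its first entry and check that the result lies in $S$. If this holds for all $i$ (the algorithm succeeds), attach to each bad chain on top the candidate chain starting at that partition. (4) Good chains, the attached (kneaded) chains, and the remaining candidate chains form the U-decomposition of $L^U(4,n)$. The recursion starts from $L(4,1)$, which is itself a chain. The resulting Sperner chain decomposition of $L(4,n)$ is obtained from the U-decomposition of $L^U(4,n)$ by kneading. *)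

theory Defs
  imports Main "HOL-Library.Disjoint_Sets"
begin

definition L :: "nat \<Rightarrow> nat \<Rightarrow> nat list set" where
  "L m n = {x. length x = m \<and> sorted_wrt (\<ge>) x \<and> (\<forall>a\<in>set x. a \<le> n)}"

abbreviation leq :: "nat list \<Rightarrow> nat list \<Rightarrow> bool" where
  "leq \<equiv> list_all2 (\<le>)"

abbreviation rank :: "nat list \<Rightarrow> nat" where
  "rank \<equiv> sum_list"

text \<open>The bound \<open>n\<close> is an explicit argument of the dual; subtraction does not truncate on \<open>L m n\<close>.\<close>

definition dual :: "nat \<Rightarrow> nat list \<Rightarrow> nat list" where
  "dual n x = rev (map (\<lambda>a. n - a) x)"

definition d :: "nat \<Rightarrow> nat \<Rightarrow> nat" where
  "d m n = (m * n + 1) div 2"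

definition LU :: "nat \<Rightarrow> nat \<Rightarrow> nat list set" where
  "LU m n = {x \<in> L m n. rank x \<le> d m n}"

text \<open>A chain is represented by its set of elements.\<close>

definition is_bottom :: "nat list set \<Rightarrow> nat list \<Rightarrow> bool" where
  "is_bottom C x \<longleftrightarrow> x \<in> C \<and> (\<forall>y\<in>C. leq x y)"

definition is_top :: "nat list set \<Rightarrow> nat list \<Rightarrow> bool" where
  "is_top C x \<longleftrightarrow> x \<in> C \<and> (\<forall>y\<in>C. leq y x)"

definition starts :: "nat list set set \<Rightarrow> nat list set" where
  "starts P = {x. \<exists>C\<in>P. is_bottom C x}"

definition chain_decomposition :: "nat list set \<Rightarrow> nat list set set \<Rightarrow> bool" where
  "chain_decomposition A P \<longleftrightarrow> partition_on A P \<and> (\<forall>C\<in>P. Complete_Partial_Order.chain leq C)"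

definition Sperner_decomposition :: "nat \<Rightarrow> nat \<Rightarrow> nat list set set \<Rightarrow> bool" where
  "Sperner_decomposition m n P \<longleftrightarrow> chain_decomposition (L m n) P \<and>
     (\<forall>C\<in>P. (\<exists>x. is_bottom C x \<and> 2 * rank x \<le> m * n) \<and>
            (\<exists>x. is_top C x \<and> m * n \<le> 2 * rank x) \<and>
            (\<exists>x\<in>C. rank x = m * n div 2))"

definition U_decomposition :: "nat \<Rightarrow> nat \<Rightarrow> nat list set set \<Rightarrow> bool" where
  "U_decomposition m n P \<longleftrightarrow> chain_decomposition (LU m n) P \<and>
     (\<forall>C\<in>P. \<exists>x. is_top C x \<and> rank x = d m n)"

definition truncate :: "nat \<Rightarrow> nat list set set \<Rightarrow> nat list set set" where
  "truncate r P = (\<lambda>C. {x\<in>C. rank x \<le> r}) ` P - {{}}"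

definition knead :: "nat \<Rightarrow> nat list set set \<Rightarrow> nat list set set" where
  "knead n P = {C \<union> dual n ` C' | C C'. C \<in> P \<and> C' \<in> P \<and>
     (\<exists>x. is_top C x \<and> is_bottom (dual n ` C') x)}"

text \<open>The condition \<open>6k + l \<le> 3n/2\<close> is stated without division.\<close>

definition S3 :: "nat \<Rightarrow> nat list set" where
  "S3 n = {[4 * k + l, 2 * k, 0] | k l. l \<noteq> 1 \<and> 4 * k + l \<le> n \<and> 2 * (6 * k + l) \<le> 3 * n}"

definition E3 :: "nat \<Rightarrow> nat list set" where
  "E3 n = dual n ` S3 n"

text \<open>
  Every element of \<open>E3 p\<close> is a partition. Hence for \<open>a = 0\<close>, where \<open>a - 1\<close> truncates to \<open>0\<close>,
  the tests with \<open>E3 (a - 1)\<close> still come out false on partitions, as they should: the triples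
  \<open>[0, 1, 0]\<close> and \<open>[0, 0, 1]\<close> are not weakly decreasing. The final \<open>undefined\<close> branch
  is not meant to be reached on partitions.
\<close>

definition phi :: "nat list \<Rightarrow> nat list" where
  "phi x = (case x of [a, b, c] \<Rightarrow>
     if [a, b, c] \<in> E3 a then [a + 1, b, c]
     else if even (b + c) \<and> [a - 1, b + 1, c] \<notin> E3 (a - 1) \<or>
             odd (b + c) \<and> [a - 1, b, c + 1] \<in> E3 (a - 1) then [a, b + 1, c]
     else if odd (b + c) \<and> [a - 1, b, c + 1] \<notin> E3 (a - 1) then [a, b, c + 1]
     else undefined)"

text \<open>Iterate \<open>phi\<close> from \<open>x\<close> up to and including the first element of \<open>E3 n\<close>.\<close>

definition phi_chain :: "nat \<Rightarrow> nat list \<Rightarrow> nat list set" where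
  "phi_chain n x = {(phi ^^ i) x | i. \<forall>j<i. (phi ^^ j) x \<notin> E3 n}"

definition SD3 :: "nat \<Rightarrow> nat list set set" where
  "SD3 n = phi_chain n ` S3 n"

definition UD3 :: "nat \<Rightarrow> nat list set set" where
  "UD3 n = truncate (d 3 n) (SD3 n)"

text \<open>In the following, \<open>P\<close> is the kneaded decomposition of \<open>L 4 (n - 1)\<close>.\<close>

definition bad_chains :: "nat \<Rightarrow> nat list set set \<Rightarrow> nat list set set" where
  "bad_chains n P = {C \<in> P. \<exists>x. is_top C x \<and> rank x < d 4 n}"

definition good_chains :: "nat \<Rightarrow> nat list set set \<Rightarrow> nat list set set" where
  "good_chains n P = truncate (d 4 n) (P - bad_chains n P)"

definition candidates :: "nat \<Rightarrow> nat list set set \<Rightarrow> nat list set set" where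
  "candidates n V = truncate (d 4 n) ((\<lambda>C. (#) n ` C) ` V)"

definition incr_hd :: "nat list \<Rightarrow> nat list" where
  "incr_hd x = (hd x + 1) # tl x"

definition attachable :: "nat list set \<Rightarrow> nat list set \<Rightarrow> bool" where
  "attachable B D \<longleftrightarrow> (\<exists>x. is_top B x \<and> is_bottom D (incr_hd x))"

text \<open>
  One call of the algorithm for \<open>L 4 n\<close>, with inputs \<open>U\<close> for \<open>LU 4 (n - 1)\<close> and \<open>V\<close> for \<open>LU 3 n\<close>;
  \<open>None\<close> means that it does not succeed.
\<close>

definition RecUD_step :: "nat \<Rightarrow> nat list set set \<Rightarrow> nat list set set \<Rightarrow> nat list set set option" where
  "RecUD_step n U V =
     (let P = knead (n - 1) U; Bad = bad_chains n P; Cand = candidates n V in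
      if \<forall>B\<in>Bad. \<forall>x. is_top B x \<longrightarrow> incr_hd x \<in> starts Cand
      then Some (good_chains n P
                 \<union> {B \<union> D | B D. B \<in> Bad \<and> D \<in> Cand \<and> attachable B D}
                 \<union> {D \<in> Cand. \<not> (\<exists>B\<in>Bad. attachable B D)})
      else None)"

text \<open>The recursion starts at \<open>n = 1\<close>; the value at \<open>0\<close> is irrelevant.\<close>

fun RecUD :: "nat \<Rightarrow> nat list set set option" where
  "RecUD 0 = None"
| "RecUD (Suc 0) = Some (truncate (d 4 1) {L 4 1})"
| "RecUD (Suc (Suc n)) =
     Option.bind (RecUD (Suc n)) (\<lambda>U. RecUD_step (Suc (Suc n)) U (UD3 (Suc (Suc n))))"

definition S4 :: "nat \<Rightarrow> nat list set" where
  "S4 n = {[6 * k + s + l, 4 * k + l, 2 * k, 0] | s l k. s \<noteq> 1 \<and> l \<noteq> 1 \<and> 6 * k + s + l \<le> n}"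

end

theory Submission
  imports Defs
begin

text \<open>
  The decomposition of \<open>LU 4 n\<close> produced by the recursion consists of chains whose starting
  partitions are exactly \<open>S4 n\<close>; this is proved by induction on \<open>n\<close>, and a final kneading
  (\<open>knead_saturated\<close>) turns it into the Sperner decomposition of \<open>L 4 n\<close>. Each step is a
  comparison of two explicit lists of partitions.

  By kneading, the end partitions of the decomposition of \<open>L 4 (n - 1)\<close> are the duals of the
  elements of \<open>S4 (n - 1)\<close>. The dual of \<open>[6k+s+l, 4k+l, 2k, 0]\<close> is
  \<open>[n-1, n-1-2k, n-1-4k-l, n-1-6k-s-l]\<close>. If its rank is less than \<open>2n\<close>, then
  \<open>12k + s + 2l \<ge> 2n - 3\<close>, whereas \<open>6k + s + l \<le> n - 1\<close>; hence \<open>s \<le> 1\<close>, and since the value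
  \<open>1\<close> is excluded, \<open>s = 0\<close> and \<open>6k + l = n - 1\<close>. Raising the first entry then gives
  \<open>[n, 4k+l, 2k, 0]\<close>, which is a starting partition of a candidate chain, so the algorithm succeeds.
  The candidate chains start at the \<open>[n, 4k+l, 2k, 0]\<close> with \<open>l \<noteq> 1\<close> and \<open>6k + l \<le> n\<close>, and those
  with \<open>6k + l = n - 1\<close> are used up by the bad chains. For the remaining ones
  \<open>s = n - 6k - l\<close> is different from \<open>1\<close>: they are the elements of \<open>S4 n\<close> with first entry \<open>n\<close>
  (\<open>S4_step\<close>). This is why \<open>s = 1\<close> does not occur in \<open>S4 n\<close>.

  Two points carry the rest. First, after prefixing \<open>n\<close>, a candidate chain is cut at rank
  \<open>2n\<close>, so only triples of rank at most \<open>n\<close> matter. On these the bound \<open>n\<close> on the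
  entries is automatic and no chain has yet reached \<open>E3 n\<close>, whose elements have rank at least
  \<open>3n/2\<close>. It therefore suffices that \<open>phi\<close> is a bijection from the set of all partitions with at most three
  parts onto those that are not of the form \<open>[4k+l, 2k, 0]\<close> with \<open>l \<noteq> 1\<close>
  (\<open>phi_step\<close>, \<open>phi_inj\<close>, \<open>phi_surj\<close>). In terms of the differences
  \<open>x = a - b\<close>, \<open>y = b - c\<close>, \<open>z = c\<close> of a triple \<open>[a, b, c]\<close> this is a parity check.

  Second, cutting a good chain at rank \<open>2n\<close> must leave a top of rank exactly \<open>2n\<close>. The
  induction therefore keeps track of the fact that no chain skips a rank, a property preserved by
  duality, gluing, truncation and prefixing (\<open>saturated_chain\<close>).
\<close>

section \<open>Chains without rank gaps\<close>

lemma leq_refl: "leq x x"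
  by (simp add: list_all2_refl)

lemma leq_trans: "leq x y \<Longrightarrow> leq y z \<Longrightarrow> leq x z"
  by (rule list_all2_trans[where ?P1.0 = "(\<le>)"]) auto

lemma rank_mono: "leq x y \<Longrightarrow> rank x \<le> rank y"
  by (induction rule: list_all2_induct) auto

text \<open>Rank is strictly monotone, so in a chain an element is determined by its rank.\<close>

lemma leq_rank_eq: "leq x y \<Longrightarrow> rank y \<le> rank x \<Longrightarrow> x = y"
proof (induction rule: list_all2_induct)
  case (Cons a x b y)
  then show ?case using rank_mono[of x y] by auto
qed simp

lemma leq_antisym: "leq x y \<Longrightarrow> leq y x \<Longrightarrow> x = y"
  using leq_rank_eq rank_mono by blast

lemma is_top_unique: "is_top C x \<Longrightarrow> is_top C y \<Longrightarrow> x = y"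
  unfolding is_top_def using leq_antisym by blast

lemma is_bottom_unique: "is_bottom C x \<Longrightarrow> is_bottom C y \<Longrightarrow> x = y"
  unfolding is_bottom_def using leq_antisym by blast

text \<open>
  The condition on ranks makes the chain pass through every rank between its two ends; a
  U-decomposition alone would allow gaps, and a good chain with a gap at the cutting rank
  could not be truncated to that rank.
\<close>

definition saturated_chain :: "nat list \<Rightarrow> nat list \<Rightarrow> nat list set \<Rightarrow> bool" where
  "saturated_chain b t C \<longleftrightarrow> Complete_Partial_Order.chain leq C \<and> is_bottom C b \<and> is_top C t \<and>
     rank ` C = {rank b..rank t}"

lemma saturated_chainD:
  assumes "saturated_chain b t C"
  shows "Complete_Partial_Order.chain leq C" "is_bottom C b" "is_top C t"
    "b \<in> C" "t \<in> C" "\<And>x. x \<in> C \<Longrightarrow> leq b x" "\<And>x. x \<in> C \<Longrightarrow> leq x t"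
    "\<And>x. x \<in> C \<Longrightarrow> rank b \<le> rank x" "\<And>x. x \<in> C \<Longrightarrow> rank x \<le> rank t"
  using assms unfolding saturated_chain_def is_bottom_def is_top_def
  by (auto intro: rank_mono)

lemma saturated_chain_element:
  assumes "saturated_chain b t C" "rank b \<le> r" "r \<le> rank t"
  obtains x where "x \<in> C" "rank x = r"
proof -
  have "r \<in> rank ` C" using assms unfolding saturated_chain_def by auto
  then show ?thesis using that by auto
qed

lemma saturated_chain_truncate:
  assumes C: "saturated_chain b t C" and r: "rank b \<le> r" "r \<le> rank t"
  shows "\<exists>x. rank x = r \<and> saturated_chain b x {y \<in> C. rank y \<le> r}"
proof -
  obtain x where x: "x \<in> C" "rank x = r" using saturated_chain_element[OF C r] .
  have top: "leq y x" if y: "y \<in> C" "rank y \<le> r" for y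
  proof -
    have "leq y x \<or> leq x y"
      using saturated_chainD(1)[OF C] x y by (auto simp: chain_def)
    then show ?thesis using leq_rank_eq[of x y] x y leq_refl by auto
  qed
  have "rank ` {y \<in> C. rank y \<le> r} = rank ` C \<inter> {..r}" by auto
  also have "rank ` C = {rank b..rank t}" using C unfolding saturated_chain_def by blast
  also have "{rank b..rank t} \<inter> {..r} = {rank b..rank x}" using x r by auto
  finally have "rank ` {y \<in> C. rank y \<le> r} = {rank b..rank x}" .
  then have "saturated_chain b x {y \<in> C. rank y \<le> r}"
    using C x top r unfolding saturated_chain_def is_bottom_def is_top_def chain_def by auto
  then show ?thesis using x by auto
qed

text \<open>
  The rank condition allows both ways of gluing: at a common element, as in kneading, and
  along a cover relation, as for a bad chain and its candidate.
\<close>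

lemma saturated_chain_Un:
  assumes C: "saturated_chain b t C" and D: "saturated_chain b' t' D"
    and tb: "leq t b'" "rank b' \<le> Suc (rank t)"
  shows "saturated_chain b t' (C \<union> D)"
proof -
  note c = saturated_chainD[OF C] and e = saturated_chainD[OF D]
  have CD: "leq x y" if "x \<in> C" "y \<in> D" for x y
    using leq_trans[OF c(7)[OF that(1)] leq_trans[OF tb(1) e(6)[OF that(2)]]] .
  have "rank ` (C \<union> D) = {rank b..rank t} \<union> {rank b'..rank t'}"
    using C D unfolding saturated_chain_def by (simp add: image_Un)
  also have "\<dots> = {rank b..rank t'}"
    using c(8)[OF c(5)] e(8)[OF e(5)] rank_mono[OF tb(1)] tb(2) by auto
  finally show ?thesis
    unfolding saturated_chain_def
    using c e CD by (auto simp: chain_def is_bottom_def is_top_def)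
qed

lemma saturated_chain_Cons:
  assumes "saturated_chain b t C"
  shows "saturated_chain (n # b) (n # t) ((#) n ` C)"
proof -
  have "rank ` ((#) n ` C) = (+) n ` rank ` C" by (auto simp: image_image)
  also have "\<dots> = {rank (n # b)..rank (n # t)}" using assms unfolding saturated_chain_def by auto
  finally show ?thesis
    using assms unfolding saturated_chain_def by (auto simp: chain_def is_bottom_def is_top_def)
qed

section \<open>Duality and kneading\<close>

lemma dual_in_L: "x \<in> L m n \<Longrightarrow> dual n x \<in> L m n"
  unfolding L_def dual_def
  by (auto simp: sorted_wrt_rev sorted_wrt_map elim!: sorted_wrt_mono_rel[rotated])

lemma dual_dual: "x \<in> L m n \<Longrightarrow> dual n (dual n x) = x"
  unfolding L_def dual_def by (auto simp: rev_map intro!: map_idI)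

lemma leq_dual: "leq x y \<Longrightarrow> leq (dual n y) (dual n x)"
proof -
  assume "leq x y"
  then have "leq (map (\<lambda>a. n - a) y) (map (\<lambda>a. n - a) x)"
    by (auto simp: list_all2_conv_all_nth intro: diff_le_mono2)
  then show ?thesis by (simp add: dual_def)
qed

lemma rank_dual: assumes "x \<in> L m n" shows "rank x + rank (dual n x) = m * n"
proof -
  have "\<forall>a\<in>set x. a \<le> n \<Longrightarrow> rank x + rank (map (\<lambda>a. n - a) x) = length x * n"
    by (induction x) auto
  then show ?thesis using assms unfolding L_def dual_def by (auto simp: sum_list_rev)
qed

lemma saturated_chain_dual:
  assumes C: "saturated_chain b t C" and CL: "C \<subseteq> L m n"
  shows "saturated_chain (dual n t) (dual n b) (dual n ` C)"
proof -
  note c = saturated_chainD[OF C]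
  have rd: "rank (dual n x) = m * n - rank x" if "x \<in> C" for x
    using rank_dual[of x m n] that CL by auto
  have le: "rank x \<le> m * n" if "x \<in> C" for x
    using rank_dual[of x m n] that CL by auto
  have "rank ` dual n ` C = (\<lambda>r. m * n - r) ` rank ` C"
    unfolding image_image using rd by (intro image_cong) auto
  also have "rank ` C = {rank b..rank t}" using C unfolding saturated_chain_def by auto
  also have "(\<lambda>r. m * n - r) ` {rank b..rank t} = {m * n - rank t..m * n - rank b}"
  proof (intro equalityI subsetI)
    fix r assume r: "r \<in> {m * n - rank t..m * n - rank b}"
    then have "r = m * n - (m * n - r)" "m * n - r \<in> {rank b..rank t}"
      using le[OF c(5)] le[OF c(4)] by auto
    then show "r \<in> (\<lambda>r. m * n - r) ` {rank b..rank t}" by (rule image_eqI)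
  qed auto
  finally have "rank ` dual n ` C = {rank (dual n t)..rank (dual n b)}"
    using rd c by auto
  then show ?thesis
    using c unfolding saturated_chain_def
    by (auto simp: chain_def is_bottom_def is_top_def leq_dual) (metis leq_dual)
qed

definition saturated_partition :: "nat list set \<Rightarrow> nat list set set \<Rightarrow> bool" where
  "saturated_partition A P \<longleftrightarrow> partition_on A P \<and> (\<forall>C\<in>P. \<exists>b t. saturated_chain b t C)"

definition ends :: "nat list set set \<Rightarrow> nat list set" where
  "ends P = {x. \<exists>C\<in>P. is_top C x}"

lemma saturated_partitionI:
  assumes "\<And>C. C \<in> P \<Longrightarrow> C \<subseteq> A" "\<And>x. x \<in> A \<Longrightarrow> \<exists>C\<in>P. x \<in> C"
    "\<And>C D x. C \<in> P \<Longrightarrow> D \<in> P \<Longrightarrow> x \<in> C \<Longrightarrow> x \<in> D \<Longrightarrow> C = D"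
    "\<And>C. C \<in> P \<Longrightarrow> \<exists>b t. saturated_chain b t C"
  shows "saturated_partition A P"
proof -
  have "{} \<notin> P" using assms(4) saturated_chainD(4) by blast
  moreover have "disjoint P" using assms(3) unfolding disjoint_def by blast
  moreover have "\<Union>P = A" using assms(1,2) by blast
  ultimately show ?thesis using assms(4) unfolding saturated_partition_def partition_on_def by auto
qed

lemma saturated_partitionD:
  assumes "saturated_partition A P"
  shows "\<And>C. C \<in> P \<Longrightarrow> C \<subseteq> A" "\<And>x. x \<in> A \<Longrightarrow> \<exists>C\<in>P. x \<in> C"
    "\<And>C D x. C \<in> P \<Longrightarrow> D \<in> P \<Longrightarrow> x \<in> C \<Longrightarrow> x \<in> D \<Longrightarrow> C = D"
    "\<And>C. C \<in> P \<Longrightarrow> \<exists>b t. saturated_chain b t C"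
  using assms unfolding saturated_partition_def partition_on_def disjoint_def by blast+

lemma starts_subset: "saturated_partition A P \<Longrightarrow> starts P \<subseteq> A"
  using saturated_partitionD(1) unfolding starts_def is_bottom_def by blast

lemma saturated_partition_U_decomposition:
  assumes "saturated_partition (LU m n) U" "\<And>x. x \<in> ends U \<Longrightarrow> rank x = d m n"
  shows "U_decomposition m n U"
  using assms saturated_chainD(1,3)
  unfolding U_decomposition_def chain_decomposition_def saturated_partition_def ends_def by blast

text \<open>A chain without gaps that starts below the middle rank and ends above it meets the middle rank.\<close>

lemma saturated_partition_Sperner_decomposition:
  assumes P: "saturated_partition (L m n) P"
    and s: "\<And>x. x \<in> starts P \<Longrightarrow> 2 * rank x \<le> m * n"
    and e: "\<And>x. x \<in> ends P \<Longrightarrow> m * n \<le> 2 * rank x"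
  shows "Sperner_decomposition m n P"
proof -
  have "(\<exists>x. is_bottom C x \<and> 2 * rank x \<le> m * n) \<and> (\<exists>x. is_top C x \<and> m * n \<le> 2 * rank x) \<and>
      (\<exists>x\<in>C. rank x = m * n div 2)" if "C \<in> P" for C
  proof -
    obtain b t where C: "saturated_chain b t C" using saturated_partitionD(4)[OF P \<open>C \<in> P\<close>] by auto
    note c = saturated_chainD[OF C]
    have b: "2 * rank b \<le> m * n" using s c(2) \<open>C \<in> P\<close> unfolding starts_def by auto
    have t: "m * n \<le> 2 * rank t" using e c(3) \<open>C \<in> P\<close> unfolding ends_def by auto
    have "\<exists>x\<in>C. rank x = m * n div 2"
      using saturated_chain_element[OF C, of "m * n div 2"] b t by fastforce
    then show ?thesis using b t c(2,3) by auto
  qed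
  then show ?thesis using P saturated_chainD(1)
    unfolding Sperner_decomposition_def chain_decomposition_def saturated_partition_def by blast
qed

text \<open>
  When \<open>m * n\<close> is even, \<open>d m n\<close> is exactly the middle rank, which duality preserves. Every chain
  of \<open>U\<close> contains exactly one element \<open>x\<close> of that rank, its top, and is glued to the dual of the
  chain with top \<open>dual n x\<close>. This pairing is symmetric and functional in both directions, so every
  chain of \<open>U\<close> serves once as lower half and once as upper half.
\<close>

lemma knead_saturated:
  assumes U: "saturated_partition (LU m n) U" and e: "\<And>x. x \<in> ends U \<Longrightarrow> rank x = d m n"
    and ev: "even (m * n)"
  shows "saturated_partition (L m n) (knead n U)"
    and "starts (knead n U) = starts U"
    and "ends (knead n U) = dual n ` starts U"
proof -
  note u = saturated_partitionD[OF U]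
  have d2: "m * n = 2 * d m n" using ev unfolding d_def by auto
  have UL: "C \<subseteq> L m n" if "C \<in> U" for C using u(1)[OF that] unfolding LU_def by auto
  have rk: "rank x \<le> d m n" if "C \<in> U" "x \<in> C" for x C using u(1)[OF that(1)] that(2) unfolding LU_def by auto
  have mid: "is_top C x" if "C \<in> U" "x \<in> C" "d m n \<le> rank x" for x C
  proof -
    obtain b t where C: "saturated_chain b t C" using u(4) \<open>C \<in> U\<close> by blast
    have "rank t = d m n" using e saturated_chainD(3)[OF C] \<open>C \<in> U\<close> unfolding ends_def by auto
    then have "x = t" using leq_rank_eq[of x t] saturated_chainD(7)[OF C] that by auto
    then show ?thesis using saturated_chainD(3)[OF C] by simp
  qed
  \<comment> \<open>The gluing relation, described by an element rather than by tops and bottoms: in this form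
    its symmetry is evident.\<close>
  define R where "R = (\<lambda>C C'. C \<in> U \<and> C' \<in> U \<and> (\<exists>x. x \<in> C \<and> dual n x \<in> C' \<and> rank x = d m n))"
  have R: "C \<in> U \<and> C' \<in> U \<and> (\<exists>x. is_top C x \<and> is_bottom (dual n ` C') x) \<longleftrightarrow> R C C'" for C C'
  proof
    assume a: "C \<in> U \<and> C' \<in> U \<and> (\<exists>x. is_top C x \<and> is_bottom (dual n ` C') x)"
    then obtain x where x: "is_top C x" "is_bottom (dual n ` C') x" by auto
    then obtain y where y: "y \<in> C'" "x = dual n y" unfolding is_bottom_def by auto
    then have "dual n x \<in> C'" using dual_dual[of y m n] UL[of C'] y a by auto
    moreover have "rank x = d m n" using e a x unfolding ends_def by auto
    ultimately show "R C C'" unfolding R_def using a x unfolding is_top_def by auto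
  next
    assume a: "R C C'"
    then obtain x where x: "C \<in> U" "C' \<in> U" "x \<in> C" "dual n x \<in> C'" "rank x = d m n"
      unfolding R_def by auto
    then have xL: "x \<in> L m n" using UL by auto
    then have "is_top C' (dual n x)" using mid[OF x(2,4)] rank_dual[OF xL] x(5) d2 by auto
    then have "is_bottom (dual n ` C') x"
      unfolding is_top_def is_bottom_def using leq_dual[of _ "dual n x" n] dual_dual[OF xL]
      by (auto simp: image_iff) metis
    then show "C \<in> U \<and> C' \<in> U \<and> (\<exists>x. is_top C x \<and> is_bottom (dual n ` C') x)"
      using x mid[OF x(1,3)] by auto
  qed
  have K: "knead n U = {C \<union> dual n ` C' | C C'. R C C'}"
    unfolding knead_def R[symmetric] by blast
  have KI: "C \<union> dual n ` C' \<in> knead n U" if "R C C'" for C C'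
    unfolding K using that by blast
  have exR: "\<exists>C'. R C C'" if C: "C \<in> U" for C
  proof -
    obtain b t where bt: "saturated_chain b t C" using u(4)[OF C] by auto
    then have t: "t \<in> C" "rank t = d m n"
      using saturated_chainD(3,5)[OF bt] e C unfolding ends_def by auto
    have tL: "t \<in> L m n" using t UL C by auto
    then have "dual n t \<in> LU m n" using t(2) rank_dual[OF tL] d2 dual_in_L unfolding LU_def by auto
    then show ?thesis using u(2) C t unfolding R_def by blast
  qed
  have symR: "R C' C" if RC: "R C C'" for C C'
  proof -
    obtain x where x: "C \<in> U" "C' \<in> U" "x \<in> C" "dual n x \<in> C'" "rank x = d m n"
      using RC unfolding R_def by auto
    have xL: "x \<in> L m n" using x UL by auto
    show ?thesis unfolding R_def using x rank_dual[OF xL] dual_dual[OF xL] d2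
      by (intro conjI exI[of _ "dual n x"]) auto
  qed
  have funR: "C' = D'" if r: "R C C'" "R C D'" for C C' D'
  proof -
    obtain x where x: "C \<in> U" "C' \<in> U" "x \<in> C" "dual n x \<in> C'" "rank x = d m n"
      using r(1) unfolding R_def by auto
    obtain y where y: "D' \<in> U" "y \<in> C" "dual n y \<in> D'" "rank y = d m n"
      using r(2) unfolding R_def by auto
    have "x = y" using is_top_unique[OF mid[OF x(1,3)] mid[OF x(1) y(2)]] x(5) y(4) by simp
    then show ?thesis using x y u(3)[of C' D' "dual n x"] by simp
  qed
  have injR: "C = D" if r: "R C C'" "R D C'" for C D C'
    using funR[OF symR[OF r(1)] symR[OF r(2)]] .
  have sat: "\<exists>b b'. is_bottom C b \<and> is_bottom C' b' \<and> saturated_chain b (dual n b') (C \<union> dual n ` C')"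
    if r: "R C C'" for C C'
  proof -
    obtain x where x: "C \<in> U" "C' \<in> U" "x \<in> C" "dual n x \<in> C'" "rank x = d m n"
      using r unfolding R_def by auto
    have xL: "x \<in> L m n" using x UL by auto
    obtain b t where C: "saturated_chain b t C" using u(4)[OF x(1)] by auto
    obtain b' t' where C': "saturated_chain b' t' C'" using u(4)[OF x(2)] by auto
    have "t = x" using is_top_unique[OF saturated_chainD(3)[OF C] mid[OF x(1,3)]] x(5) by simp
    moreover have "t' = dual n x"
      using is_top_unique[OF saturated_chainD(3)[OF C'] mid[OF x(2,4)]] x(5) rank_dual[OF xL] d2 by simp
    ultimately have "saturated_chain b (dual n b') (C \<union> dual n ` C')"
      using saturated_chain_Un[OF C saturated_chain_dual[OF C' UL[OF x(2)]]] dual_dual[OF xL] leq_refl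
      by auto
    then show ?thesis using saturated_chainD(2)[OF C] saturated_chainD(2)[OF C'] by blast
  qed
  have RU: "C \<in> U" "C' \<in> U" if "R C C'" for C C' using that unfolding R_def by auto
  have upper: "dual n x \<in> C'" "d m n \<le> rank x" "x \<in> L m n" if x: "C' \<in> U" "x \<in> dual n ` C'" for x C'
  proof -
    obtain y where y: "y \<in> C'" "x = dual n y" using x by auto
    have yL: "y \<in> L m n" using UL x y by auto
    show "dual n x \<in> C'" using y dual_dual[OF yL] by auto
    show "d m n \<le> rank x" using rank_dual[OF yL] rk[OF x(1) y(1)] d2 y by auto
    show "x \<in> L m n" using dual_in_L[OF yL] y by auto
  qed
  \<comment> \<open>A lower and an upper half can meet only in the middle rank, where they are glued to each other.\<close>
  have eqC: "C = D" if r: "R C C'" "R D D'" and x: "x \<in> C" "x \<in> dual n ` D'" for C C' D D' x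
  proof -
    have "rank x = d m n" "dual n x \<in> D'"
      using rk[OF RU(1)[OF r(1)] x(1)] upper[OF RU(2)[OF r(2)] x(2)] by auto
    then have "R C D'" unfolding R_def using RU r x by auto
    then show ?thesis using injR r by auto
  qed
  have disj: "C = D" if r: "R C C'" "R D D'" and x: "x \<in> C \<union> dual n ` C'" "x \<in> D \<union> dual n ` D'"
    for C C' D D' x
  proof -
    consider "x \<in> C" "x \<in> D" | "x \<in> C" "x \<in> dual n ` D'" | "x \<in> D" "x \<in> dual n ` C'"
      | "x \<in> dual n ` C'" "x \<in> dual n ` D'" using x by blast
    then show ?thesis
    proof cases
      case 1 then show ?thesis using u(3)[OF RU(1)[OF r(1)] RU(1)[OF r(2)]] by blast
    next
      case 2 then show ?thesis using eqC[OF r] by blast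
    next
      case 3 then show ?thesis using eqC[OF r(2,1)] by blast
    next
      case 4
      then have "C' = D'"
        using upper(1) u(3)[OF RU(2)[OF r(1)] RU(2)[OF r(2)]] RU(2) r by blast
      then show ?thesis using injR[OF r(1)] r(2) by blast
    qed
  qed
  show "saturated_partition (L m n) (knead n U)"
  proof (rule saturated_partitionI)
    fix X assume "X \<in> knead n U"
    then obtain C C' where X: "X = C \<union> dual n ` C'" "R C C'" unfolding K by auto
    show "X \<subseteq> L m n" using X UL RU upper(3) by blast
    show "\<exists>b t. saturated_chain b t X" using sat X by blast
  next
    fix x assume x: "x \<in> L m n"
    show "\<exists>X\<in>knead n U. x \<in> X"
    proof (cases "rank x \<le> d m n")
      case True
      then obtain C where "C \<in> U" "x \<in> C" using x u(2)[of x] unfolding LU_def by auto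
      then show ?thesis using exR[of C] KI by blast
    next
      case False
      then have "dual n x \<in> LU m n" using rank_dual[OF x] dual_in_L[OF x] d2 unfolding LU_def by auto
      then obtain C where C: "C \<in> U" "dual n x \<in> C" using u(2) by auto
      have x': "x \<in> dual n ` C" using imageI[OF C(2), of "dual n"] dual_dual[OF x] by simp
      obtain C' where "R C C'" using exR[OF C(1)] by blast
      then have "R C' C" by (rule symR)
      then have "C' \<union> dual n ` C \<in> knead n U" by (rule KI)
      then show ?thesis using UnI2[OF x'] by (rule bexI[rotated])
    qed
  next
    fix X Y x assume X: "X \<in> knead n U" and Y: "Y \<in> knead n U" and x: "x \<in> X" "x \<in> Y"
    obtain C C' where C: "X = C \<union> dual n ` C'" "R C C'" using X unfolding K by blast
    obtain D D' where D: "Y = D \<union> dual n ` D'" "R D D'" using Y unfolding K by blast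
    have "C = D" using disj[OF C(2) D(2)] x C(1) D(1) by blast
    then show "X = Y" using funR[OF C(2)] C(1) D by blast
  qed
  have endpoints: "\<exists>b b'. is_bottom C b \<and> is_bottom C' b' \<and>
      (\<forall>x. is_bottom (C \<union> dual n ` C') x \<longleftrightarrow> x = b) \<and> (\<forall>x. is_top (C \<union> dual n ` C') x \<longleftrightarrow> x = dual n b')"
    if "R C C'" for C C'
    using sat[OF that] is_bottom_unique is_top_unique saturated_chainD(2,3) by metis
  show "starts (knead n U) = starts U"
  proof (intro equalityI subsetI)
    fix x assume "x \<in> starts (knead n U)"
    then obtain C C' where C: "R C C'" "is_bottom (C \<union> dual n ` C') x" unfolding K starts_def by auto
    then show "x \<in> starts U" using endpoints[OF C(1)] RU[OF C(1)] unfolding starts_def by auto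
  next
    fix x assume "x \<in> starts U"
    then obtain C where C: "C \<in> U" "is_bottom C x" unfolding starts_def by auto
    obtain C' where C': "R C C'" using exR[OF C(1)] by blast
    then have "is_bottom (C \<union> dual n ` C') x" using endpoints[OF C'] is_bottom_unique[OF C(2)] by blast
    then show "x \<in> starts (knead n U)" using C' unfolding K starts_def by blast
  qed
  show "ends (knead n U) = dual n ` starts U"
  proof (intro equalityI subsetI)
    fix x assume "x \<in> ends (knead n U)"
    then obtain C C' where C: "R C C'" "is_top (C \<union> dual n ` C') x" unfolding K ends_def by auto
    then show "x \<in> dual n ` starts U" using endpoints[OF C(1)] RU[OF C(1)] unfolding starts_def by auto
  next
    fix x assume "x \<in> dual n ` starts U"
    then obtain C' y where C': "C' \<in> U" "is_bottom C' y" "x = dual n y" unfolding starts_def by auto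
    obtain C where "R C' C" using exR[OF C'(1)] by blast
    then have C: "R C C'" by (rule symR)
    then have "is_top (C \<union> dual n ` C') x"
      using endpoints[OF C] is_bottom_unique[OF C'(2)] C'(3) by blast
    then show "x \<in> ends (knead n U)" using C unfolding K ends_def by blast
  qed
qed

section \<open>The map on partitions with three parts\<close>

text \<open>The parameters are the successive differences of a triple; they range freely over the naturals.\<close>

definition partitions3 :: "nat list set" where
  "partitions3 = {[x + y + z, y + z, z] | x y z. True}"

text \<open>The starting triples of \<^const>\<open>S3\<close>, without a bound on the entries.\<close>

definition phi_minimal :: "nat list set" where
  "phi_minimal = {[4 * k + l, 2 * k, 0] | k l. l \<noteq> 1}"

lemma partitions3_iff: "[a, b, c] \<in> partitions3 \<longleftrightarrow> c \<le> b \<and> b \<le> a"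
proof
  assume "c \<le> b \<and> b \<le> a"
  then have "[a, b, c] = [(a - b) + (b - c) + c, (b - c) + c, c]" by simp
  then show "[a, b, c] \<in> partitions3" unfolding partitions3_def by blast
qed (auto simp: partitions3_def)

text \<open>
  The dual of \<open>[4k+l, 2k, 0]\<close> with respect to \<open>a\<close> has first differences \<open>2k\<close> and \<open>2k + l\<close>, while
  its last entry is arbitrary. The rank condition of \<^const>\<open>S3\<close> then holds automatically: it
  reads \<open>a - b \<le> (b - c) + 3 * c\<close>.
\<close>

lemma E3_iff:
  "[a, b, c] \<in> E3 a \<longleftrightarrow> c \<le> b \<and> b \<le> a \<and> even (a - b) \<and> a - b \<le> b - c \<and> b - c \<noteq> a - b + 1"
proof
  assume "[a, b, c] \<in> E3 a"
  then show "c \<le> b \<and> b \<le> a \<and> even (a - b) \<and> a - b \<le> b - c \<and> b - c \<noteq> a - b + 1"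
    unfolding E3_def S3_def dual_def by auto
next
  assume a: "c \<le> b \<and> b \<le> a \<and> even (a - b) \<and> a - b \<le> b - c \<and> b - c \<noteq> a - b + 1"
  then obtain k where k: "a - b = 2 * k" by (metis evenE)
  define l where "l = b - c - 2 * k"
  have "[a, b, c] = dual a [4 * k + l, 2 * k, 0]" "l \<noteq> 1" "4 * k + l \<le> a" "2 * (6 * k + l) \<le> 3 * a"
    using a k unfolding l_def dual_def by auto
  then show "[a, b, c] \<in> E3 a" unfolding E3_def S3_def by blast
qed

text \<open>
  In the differences \<open>x, y, z\<close> the three branches of \<^const>\<open>phi\<close> send \<open>(x, y, z)\<close> to
  \<open>(x + 1, y, z)\<close>, \<open>(x - 1, y + 1, z)\<close> and \<open>(x, y - 1, z + 1)\<close>, and the choice depends on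
  \<open>x\<close> and \<open>y\<close> only. In particular the undefined branch is never reached: there \<open>x\<close> and \<open>y\<close> are even
  with \<open>y + 2 \<ge> x\<close> and \<open>y + 2 \<noteq> x\<close>, so \<open>y \<ge> x\<close> and the first branch applies.
\<close>

lemma phi_cases:
  "phi [x + y + z, y + z, z] =
    (if even x \<and> x \<le> y \<and> y \<noteq> x + 1 then [Suc (x + y + z), y + z, z]
     else if even y \<or> odd x \<and> x \<le> y then [x + y + z, Suc (y + z), z]
     else [x + y + z, y + z, Suc z])"
proof -
  have 1: "[x + y + z, y + z, z] \<in> E3 (x + y + z) \<longleftrightarrow> even x \<and> x \<le> y \<and> y \<noteq> x + 1"
    by (simp add: E3_iff)
  have 2: "[x + y + z - 1, y + z + 1, z] \<in> E3 (x + y + z - 1) \<longleftrightarrow>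
      2 \<le> x \<and> even x \<and> x \<le> y + 3 \<and> y + 2 \<noteq> x"
    unfolding E3_iff by auto
  have 3: "[x + y + z - 1, y + z, z + 1] \<in> E3 (x + y + z - 1) \<longleftrightarrow>
      odd x \<and> x \<le> y \<and> y \<noteq> x + 1"
    unfolding E3_iff by (cases x) auto
  show ?thesis
    unfolding phi_def list.case 1 2 3
    by (cases "even x"; cases "even y") (auto, presburger+)
qed

lemma phi_minimal_iff:
  "[x + y + z, y + z, z] \<in> phi_minimal \<longleftrightarrow> z = 0 \<and> even y \<and> y \<le> x \<and> x \<noteq> y + 1"
proof
  assume a: "z = 0 \<and> even y \<and> y \<le> x \<and> x \<noteq> y + 1"
  then have "[x + y + z, y + z, z] = [4 * (y div 2) + (x - y), 2 * (y div 2), 0]" "x - y \<noteq> 1" by auto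
  then show "[x + y + z, y + z, z] \<in> phi_minimal" unfolding phi_minimal_def by blast
qed (auto simp: phi_minimal_def)

lemma partitions3E:
  assumes "w \<in> partitions3" obtains x y z where "w = [x + y + z, y + z, z]"
  using assms unfolding partitions3_def by blast

lemma partitions3I: "[x + y + z, y + z, z] \<in> partitions3"
  unfolding partitions3_def by blast

text \<open>
  The first branch makes \<open>x\<close> odd with \<open>x \<le> y + 1\<close> and the third makes \<open>z\<close> positive. The second
  makes \<open>y\<close> odd, or makes \<open>x\<close> and \<open>y\<close> even with \<open>x < y\<close>. None of these triples is minimal.
\<close>

lemma phi_step:
  assumes "w \<in> partitions3"
  shows "phi w \<in> partitions3 - phi_minimal" "leq w (phi w)" "rank (phi w) = Suc (rank w)"
proof -
  obtain x y z where w: "w = [x + y + z, y + z, z]" using partitions3E[OF assms] .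
  consider (A) "even x" "x \<le> y" "y \<noteq> x + 1"
    | (B) "even y \<or> odd x \<and> x \<le> y" "\<not> (even x \<and> x \<le> y \<and> y \<noteq> x + 1)"
    | (D) "\<not> (even x \<and> x \<le> y \<and> y \<noteq> x + 1)" "\<not> (even y \<or> odd x \<and> x \<le> y)" by blast
  then have "phi w \<in> partitions3 - phi_minimal \<and> leq w (phi w) \<and> rank (phi w) = Suc (rank w)"
  proof cases
    case A
    then have "phi w = [Suc x + y + z, y + z, z]" unfolding w phi_cases by simp
    moreover have "[Suc x + y + z, y + z, z] \<notin> phi_minimal" unfolding phi_minimal_iff using A by auto
    ultimately show ?thesis using w partitions3I[of "Suc x" y z] by simp
  next
    case B
    then obtain x' where x': "x = Suc x'" by (cases x) auto
    have "phi w = [x' + Suc y + z, Suc y + z, z]"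
      using B unfolding w phi_cases by (auto simp: x')
    moreover have "[x' + Suc y + z, Suc y + z, z] \<notin> phi_minimal"
      unfolding phi_minimal_iff using B x' by auto
    ultimately show ?thesis using w x' partitions3I[of "x'" "Suc y" z] by simp
  next
    case D
    then obtain y' where y': "y = Suc y'" by (cases y) auto
    have "phi w = [x + y' + Suc z, y' + Suc z, Suc z]"
      using D unfolding w phi_cases by (auto simp: y')
    moreover have "[x + y' + Suc z, y' + Suc z, Suc z] \<notin> phi_minimal" unfolding phi_minimal_iff by simp
    ultimately show ?thesis using w y' partitions3I[of x y' "Suc z"] by simp
  qed
  then show "phi w \<in> partitions3 - phi_minimal" "leq w (phi w)" "rank (phi w) = Suc (rank w)" by auto
qed

text \<open>The images of the branches are told apart by the parities and the order of \<open>x\<close> and \<open>y\<close>.\<close>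

lemma phi_inj: "inj_on phi partitions3"
proof (rule inj_onI)
  fix v w assume v: "v \<in> partitions3" and w: "w \<in> partitions3" and eq: "phi v = phi w"
  obtain x y z where v': "v = [x + y + z, y + z, z]" using partitions3E[OF v] .
  obtain x' y' z' where w': "w = [x' + y' + z', y' + z', z']" using partitions3E[OF w] .
  show "v = w"
    using eq unfolding v' w' phi_cases by (auto split: if_splits) presburger+
qed

text \<open>
  The parities and the order of \<open>x\<close> and \<open>y\<close> name the only branch that can produce a triple. Where
  this is the third branch, a predecessor exists as soon as \<open>z > 0\<close>; for \<open>z = 0\<close> the triple is
  minimal.
\<close>

lemma phi_surj:
  assumes w: "w \<in> partitions3" "w \<notin> phi_minimal"
  shows "\<exists>v\<in>partitions3. phi v = w"
proof -
  obtain x y z where w': "w = [x + y + z, y + z, z]" using partitions3E[OF w(1)] .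
  have "odd x \<and> x \<le> y + 1 \<and> y \<noteq> x \<or>
      (odd y \<and> (even x \<or> y \<le> x) \<or> even y \<and> even x \<and> x + 2 \<le> y) \<or>
      even y \<and> (odd x \<and> y + 1 < x \<or> even x \<and> y \<le> x) \<and> 0 < z"
    using w(2) unfolding w' phi_minimal_iff by presburger
  then consider (A) "odd x" "x \<le> y + 1" "y \<noteq> x" | (BC) "odd y \<and> (even x \<or> y \<le> x) \<or> even y \<and> even x \<and> x + 2 \<le> y"
    | (D) "even y" "odd x \<and> y + 1 < x \<or> even x \<and> y \<le> x" "0 < z"
    by blast
  then show ?thesis
  proof cases
    case A
    then obtain x' where x': "x = Suc x'" by (cases x) auto
    have "phi [x' + y + z, y + z, z] = w" unfolding phi_cases w' using A x' by auto
    then show ?thesis using partitions3I by blast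
  next
    case BC
    then obtain y' where y': "y = Suc y'" by (cases y) auto
    have "phi [Suc x + y' + z, y' + z, z] = w" unfolding phi_cases w' using BC y' by auto
    then show ?thesis using partitions3I by blast
  next
    case D
    then obtain z' where z': "z = Suc z'" by (cases z) auto
    have "phi [x + Suc y + z', Suc y + z', z'] = w"
      unfolding phi_cases w' using D z' by (auto, presburger)
    then show ?thesis using partitions3I by blast
  qed
qed

text \<open>
  Unlike \<^const>\<open>phi_chain\<close>, the orbit is cut by rank instead of being stopped at \<^const>\<open>E3\<close>.
\<close>

definition phi_orbit :: "nat \<Rightarrow> nat list \<Rightarrow> nat list set" where
  "phi_orbit r w = {(phi ^^ i) w | i. rank w + i \<le> r}"

lemma phi_funpow:
  assumes "w \<in> partitions3"
  shows "(phi ^^ i) w \<in> partitions3" "rank ((phi ^^ i) w) = rank w + i"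
proof -
  have "(phi ^^ i) w \<in> partitions3 \<and> rank ((phi ^^ i) w) = rank w + i"
    using assms phi_step by (induction i) auto
  then show "(phi ^^ i) w \<in> partitions3" "rank ((phi ^^ i) w) = rank w + i" by auto
qed

lemma phi_funpow_mono:
  assumes "w \<in> partitions3" "i \<le> j"
  shows "leq ((phi ^^ i) w) ((phi ^^ j) w)"
  using assms(2)
proof (induction j rule: dec_induct)
  case (step j)
  then show ?case using leq_trans phi_step(2)[OF phi_funpow(1)[OF assms(1)]] by auto
qed (rule leq_refl)

lemma phi_orbit_saturated:
  assumes w: "w \<in> partitions3" and r: "rank w \<le> r"
  shows "saturated_chain w ((phi ^^ (r - rank w)) w) (phi_orbit r w)"
proof -
  let ?t = "(phi ^^ (r - rank w)) w"
  have "rank ` phi_orbit r w = {s. \<exists>i. s = rank w + i \<and> rank w + i \<le> r}"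
    unfolding phi_orbit_def using phi_funpow(2)[OF w] by (auto simp: image_iff) metis
  also have "\<dots> = {rank w..rank ?t}" using phi_funpow(2)[OF w] r by (auto simp: le_iff_add)
  finally have ranks: "rank ` phi_orbit r w = {rank w..rank ?t}" .
  have "Complete_Partial_Order.chain leq (phi_orbit r w)"
  proof (rule chainI)
    fix x y assume "x \<in> phi_orbit r w" "y \<in> phi_orbit r w"
    then obtain i j where "x = (phi ^^ i) w" "y = (phi ^^ j) w" unfolding phi_orbit_def by blast
    then show "leq x y \<or> leq y x" using phi_funpow_mono[OF w] by (cases "i \<le> j") auto
  qed
  moreover have "is_bottom (phi_orbit r w) w"
    unfolding is_bottom_def phi_orbit_def using phi_funpow_mono[OF w, of 0] r
    by (auto intro: exI[of _ 0])
  moreover have "is_top (phi_orbit r w) ?t"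
    unfolding is_top_def phi_orbit_def using phi_funpow_mono[OF w] r by auto
  ultimately show ?thesis using ranks unfolding saturated_chain_def by blast
qed

lemma phi_minimal_subset: "phi_minimal \<subseteq> partitions3"
  unfolding phi_minimal_def by (auto simp: partitions3_iff)

text \<open>
  Injectivity strips off common applications of \<^const>\<open>phi\<close>; a minimal triple has no predecessor,
  so both numbers of iterations run out at the same time.
\<close>

lemma phi_funpow_disjoint:
  assumes v: "v \<in> phi_minimal" and w: "w \<in> phi_minimal" and "(phi ^^ i) v = (phi ^^ j) w"
  shows "v = w"
  using assms(3)
proof (induction i arbitrary: j)
  case 0
  show ?case
  proof (cases j)
    case (Suc j')
    have "v = phi ((phi ^^ j') w)" using 0 Suc by simp
    then have "v \<notin> phi_minimal" using phi_step(1) phi_funpow(1) w phi_minimal_subset by blast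
    then show ?thesis using v by simp
  qed (use 0 in simp)
next
  case (Suc i)
  show ?case
  proof (cases j)
    case 0
    have "w = phi ((phi ^^ i) v)" using 0 Suc.prems by simp
    then have "w \<notin> phi_minimal" using phi_step(1) phi_funpow(1) v phi_minimal_subset by blast
    then show ?thesis using w by simp
  next
    case (Suc j')
    then have "(phi ^^ i) v = (phi ^^ j') w"
      using Suc.prems inj_onD[OF phi_inj, of "(phi ^^ i) v" "(phi ^^ j') w"]
        phi_funpow(1) v w phi_minimal_subset by auto
    then show ?thesis by (rule Suc.IH)
  qed
qed

text \<open>Going backwards along \<^const>\<open>phi\<close> lowers the rank, so it ends at a minimal triple.\<close>

lemma phi_orbits_cover:
  "w \<in> partitions3 \<Longrightarrow> \<exists>m\<in>phi_minimal. \<exists>i. w = (phi ^^ i) m"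
proof (induction "rank w" arbitrary: w rule: less_induct)
  case less
  show ?case
  proof (cases "w \<in> phi_minimal")
    case True
    then show ?thesis by (intro bexI[of _ w] exI[of _ 0]) auto
  next
    case False
    then obtain v where v: "v \<in> partitions3" "phi v = w" using phi_surj less.prems by auto
    then obtain m i where "m \<in> phi_minimal" "v = (phi ^^ i) m"
      using less.hyps[of v] phi_step(3)[of v] by auto
    then show ?thesis using v(2) by (intro bexI[of _ m] exI[of _ "Suc i"]) auto
  qed
qed

lemma phi_orbits_saturated_partition:
  "saturated_partition {w \<in> partitions3. rank w \<le> r} (phi_orbit r ` {m \<in> phi_minimal. rank m \<le> r})"
proof (rule saturated_partitionI)
  fix x assume x: "x \<in> {w \<in> partitions3. rank w \<le> r}"
  then obtain m i where m: "m \<in> phi_minimal" "x = (phi ^^ i) m"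
    using phi_orbits_cover by blast
  then have "rank m + i \<le> r" using x phi_funpow(2)[of m i] phi_minimal_subset by auto
  then have "m \<in> {m \<in> phi_minimal. rank m \<le> r}" "x \<in> phi_orbit r m"
    using m unfolding phi_orbit_def by auto
  then show "\<exists>C\<in>phi_orbit r ` {m \<in> phi_minimal. rank m \<le> r}. x \<in> C" by blast
next
  fix C assume "C \<in> phi_orbit r ` {m \<in> phi_minimal. rank m \<le> r}"
  then obtain m where m: "m \<in> partitions3" "rank m \<le> r" "C = phi_orbit r m"
    using phi_minimal_subset by auto
  show "C \<subseteq> {w \<in> partitions3. rank w \<le> r}"
    using phi_funpow[OF m(1)] unfolding m(3) phi_orbit_def by auto
  show "\<exists>b t. saturated_chain b t C" using phi_orbit_saturated m by blast
next
  fix C D x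
  assume "C \<in> phi_orbit r ` {m \<in> phi_minimal. rank m \<le> r}"
    "D \<in> phi_orbit r ` {m \<in> phi_minimal. rank m \<le> r}" "x \<in> C" "x \<in> D"
  then show "C = D" unfolding phi_orbit_def using phi_funpow_disjoint by blast
qed

section \<open>The candidate chains\<close>

lemma d4: "d 4 n = 2 * n"
  unfolding d_def by simp

lemma E3_rank: "w \<in> E3 n \<Longrightarrow> 3 * n \<le> 2 * rank w"
  unfolding E3_def S3_def dual_def by auto

lemma S3_rank_le: "{m \<in> S3 n. rank m \<le> n} = {m \<in> phi_minimal. rank m \<le> n}"
  unfolding S3_def phi_minimal_def by (auto; fastforce)

text \<open>
  A partition of rank less than \<open>n\<close> cannot lie in \<open>E3 n\<close>, so the stopping rule has no
  effect up to rank \<open>n\<close>.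
\<close>

lemma phi_chain_truncate:
  assumes m: "m \<in> partitions3"
  shows "{x \<in> phi_chain n m. rank x \<le> n} = phi_orbit n m"
proof (intro equalityI subsetI)
  fix x assume "x \<in> phi_orbit n m"
  then obtain i where i: "x = (phi ^^ i) m" "rank m + i \<le> n" unfolding phi_orbit_def by auto
  have "(phi ^^ j) m \<notin> E3 n" if "j < i" for j
    using E3_rank[of "(phi ^^ j) m" n] phi_funpow(2)[OF m, of j] i(2) that by auto
  then show "x \<in> {x \<in> phi_chain n m. rank x \<le> n}"
    unfolding phi_chain_def using i phi_funpow(2)[OF m, of i] by auto
qed (auto simp: phi_chain_def phi_orbit_def phi_funpow(2)[OF m])

text \<open>
  Prefixing \<open>n\<close> turns the cut at rank \<open>2n\<close> into one at rank \<open>n \<le> d 3 n\<close>, which makes the first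
  truncation redundant. The chains that survive are those starting at rank at most \<open>n\<close>.
\<close>

lemma candidates_UD3:
  "candidates n (UD3 n) = (\<lambda>m. (#) n ` phi_orbit n m) ` {m \<in> phi_minimal. rank m \<le> n}"
proof -
  let ?cut = "\<lambda>C. {x \<in> (#) n ` {y \<in> C. rank y \<le> d 3 n}. rank x \<le> d 4 n}"
  have S3: "m \<in> partitions3" if "m \<in> S3 n" for m
    using that unfolding S3_def by (auto simp: partitions3_iff)
  have "candidates n (UD3 n) = ?cut ` phi_chain n ` S3 n - {{}}"
    unfolding candidates_def UD3_def SD3_def truncate_def by auto
  also have "?cut ` phi_chain n ` S3 n = (\<lambda>m. (#) n ` phi_orbit n m) ` S3 n"
    unfolding image_image
  proof (rule image_cong[OF refl])
    fix m assume "m \<in> S3 n"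
    have "?cut (phi_chain n m) = (#) n ` {x \<in> phi_chain n m. rank x \<le> n}"
      unfolding d4 by (auto simp: d_def)
    then show "?cut (phi_chain n m) = (#) n ` phi_orbit n m"
      using phi_chain_truncate[OF S3[OF \<open>m \<in> S3 n\<close>]] by simp
  qed
  also have "\<dots> - {{}} = (\<lambda>m. (#) n ` phi_orbit n m) ` {m \<in> S3 n. rank m \<le> n}"
  proof -
    have "phi_orbit n m = {} \<longleftrightarrow> n < rank m" for m
    proof
      assume "phi_orbit n m = {}"
      then have "(phi ^^ 0) m \<notin> phi_orbit n m" by blast
      then show "n < rank m" unfolding phi_orbit_def by (metis (mono_tags, lifting) CollectI add_0_right not_less)
    qed (auto simp: phi_orbit_def)
    then show ?thesis by force
  qed
  finally show ?thesis unfolding S3_rank_le .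
qed

lemma saturated_partition_Cons:
  assumes P: "saturated_partition A P"
  shows "saturated_partition ((#) n ` A) ((`) ((#) n) ` P)"
proof (rule saturated_partitionI)
  note p = saturated_partitionD[OF P]
  show "C \<subseteq> (#) n ` A" if "C \<in> (`) ((#) n) ` P" for C using that p(1) by auto
  show "\<exists>C\<in>(`) ((#) n) ` P. x \<in> C" if x: "x \<in> (#) n ` A" for x
  proof -
    obtain y where "y \<in> A" "x = n # y" using x by auto
    moreover then obtain C where "C \<in> P" "y \<in> C" using p(2) by auto
    ultimately show ?thesis by auto
  qed
  show "\<exists>b t. saturated_chain b t C" if C: "C \<in> (`) ((#) n) ` P" for C
  proof -
    obtain C' where C': "C' \<in> P" "C = (#) n ` C'" using C by auto
    then show ?thesis using p(4)[OF C'(1)] saturated_chain_Cons by blast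
  qed
  show "C = D" if CD: "C \<in> (`) ((#) n) ` P" "D \<in> (`) ((#) n) ` P" and x: "x \<in> C" "x \<in> D" for C D x
  proof -
    obtain C' D' where CD': "C' \<in> P" "C = (#) n ` C'" "D' \<in> P" "D = (#) n ` D'" using CD by auto
    obtain y where "y \<in> C'" "y \<in> D'" using x CD' by auto
    then have "C' = D'" by (rule p(3)[OF CD'(1,3)])
    then show ?thesis using CD' by simp
  qed
qed

lemma candidates_saturated_partition:
  shows "saturated_partition ((#) n ` {w \<in> partitions3. rank w \<le> n}) (candidates n (UD3 n))"
    and "starts (candidates n (UD3 n)) = (#) n ` {m \<in> phi_minimal. rank m \<le> n}"
    and "\<And>x. x \<in> ends (candidates n (UD3 n)) \<Longrightarrow> rank x = d 4 n"
proof -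
  have eq: "candidates n (UD3 n) = (`) ((#) n) ` phi_orbit n ` {m \<in> phi_minimal. rank m \<le> n}"
    unfolding candidates_UD3 image_image ..
  show "saturated_partition ((#) n ` {w \<in> partitions3. rank w \<le> n}) (candidates n (UD3 n))"
    unfolding eq by (rule saturated_partition_Cons[OF phi_orbits_saturated_partition])
  have c: "saturated_chain (n # m) (n # (phi ^^ (n - rank m)) m) ((#) n ` phi_orbit n m)"
    if "m \<in> phi_minimal" "rank m \<le> n" for m
    using saturated_chain_Cons phi_orbit_saturated that phi_minimal_subset by blast
  have "is_bottom ((#) n ` phi_orbit n m) x \<longleftrightarrow> x = n # m" if "m \<in> phi_minimal" "rank m \<le> n" for m x
    using saturated_chainD(2)[OF c[OF that]] is_bottom_unique by blast
  then show "starts (candidates n (UD3 n)) = (#) n ` {m \<in> phi_minimal. rank m \<le> n}"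
    unfolding starts_def candidates_UD3 by auto
  show "rank x = d 4 n" if x: "x \<in> ends (candidates n (UD3 n))" for x
  proof -
    obtain m where m: "m \<in> phi_minimal" "rank m \<le> n" "is_top ((#) n ` phi_orbit n m) x"
      using x unfolding ends_def candidates_UD3 by auto
    then have "x = n # (phi ^^ (n - rank m)) m"
      using saturated_chainD(3)[OF c] is_top_unique by blast
    then show ?thesis using phi_funpow(2)[of m "n - rank m"] m phi_minimal_subset d4 by auto
  qed
qed

section \<open>One call of the algorithm\<close>

text \<open>
  Only the shape of the two decompositions matters here: they live on disjoint sets, chains of the
  first start low enough and chains of the second end at the right rank. A bad chain
  determines its candidate because candidates are disjoint; a candidate determines its bad
  chain because raising the first entry is injective. So no old chain contributes to two chains
  of the result, and a start disappears exactly when its candidate is attached.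
\<close>

lemma RecUD_step_saturated_partition:
  fixes n U V
  defines "P \<equiv> knead (n - 1) U" and "Q \<equiv> candidates n V"
  assumes P: "saturated_partition A P" and Q: "saturated_partition B Q" and AB: "A \<inter> B = {}"
    and Nil: "[] \<notin> A"
    and sP: "\<And>x. x \<in> starts P \<Longrightarrow> rank x \<le> d 4 n"
    and eQ: "\<And>x. x \<in> ends Q \<Longrightarrow> rank x = d 4 n"
    and bad: "\<And>x. x \<in> ends P \<Longrightarrow> rank x < d 4 n \<Longrightarrow> incr_hd x \<in> starts Q"
  shows "\<exists>W. RecUD_step n U V = Some W \<and>
    saturated_partition ({x \<in> A. rank x \<le> d 4 n} \<union> B) W \<and> (\<forall>x\<in>ends W. rank x = d 4 n) \<and>
    starts W = starts P \<union> (starts Q - incr_hd ` {x \<in> ends P. rank x < d 4 n})"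
proof -
  note p = saturated_partitionD[OF P] and q = saturated_partitionD[OF Q]
  define W where "W = good_chains n P
     \<union> {C \<union> D | C D. C \<in> bad_chains n P \<and> D \<in> Q \<and> attachable C D}
     \<union> {D \<in> Q. \<not> (\<exists>C\<in>bad_chains n P. attachable C D)}"
  have "\<forall>C\<in>bad_chains n P. \<forall>x. is_top C x \<longrightarrow> incr_hd x \<in> starts Q"
    using bad is_top_unique unfolding bad_chains_def ends_def by fastforce
  then have step: "RecUD_step n U V = Some W"
    unfolding RecUD_step_def Let_def P_def[symmetric] Q_def[symmetric] W_def by simp
  have bad_iff: "C \<in> bad_chains n P \<longleftrightarrow> rank t < d 4 n" if "C \<in> P" "is_top C t" for C t
    using that is_top_unique unfolding bad_chains_def by auto
  have badP: "C \<in> P" if "C \<in> bad_chains n P" for C using that unfolding bad_chains_def by auto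
  have incr: "leq x (incr_hd x)" "rank (incr_hd x) = Suc (rank x)" if "x \<in> A" for x
    using that Nil leq_refl by (cases x; auto simp: incr_hd_def)+
  have incr_inj: "x = y" if "x \<in> A" "y \<in> A" "incr_hd x = incr_hd y" for x y
    using that Nil by (cases x; cases y) (auto simp: incr_hd_def)
  have PQ: "x \<notin> D" if "C \<in> P" "D \<in> Q" "x \<in> C" for C D x using p(1) q(1) AB that by blast
  have att_fun: "D = D'" if a: "attachable C D" "attachable C D'" and D: "D \<in> Q" "D' \<in> Q" for C D D'
  proof -
    obtain x where "is_top C x" "is_bottom D (incr_hd x)" using a(1) unfolding attachable_def by blast
    moreover obtain y where "is_top C y" "is_bottom D' (incr_hd y)" using a(2) unfolding attachable_def by blast
    ultimately show ?thesis using q(3)[OF D] is_top_unique unfolding is_bottom_def by blast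
  qed
  have att_inj: "C = C'" if a: "attachable C D" "attachable C' D" and C: "C \<in> P" "C' \<in> P" for C C' D
  proof -
    obtain x where x: "is_top C x" "is_bottom D (incr_hd x)" using a(1) unfolding attachable_def by blast
    obtain y where y: "is_top C' y" "is_bottom D (incr_hd y)" using a(2) unfolding attachable_def by blast
    have m: "x \<in> C" "y \<in> C'" using x y unfolding is_top_def by auto
    have "incr_hd x = incr_hd y" using is_bottom_unique[OF x(2) y(2)] .
    then have "x = y" using incr_inj m p(1) C by blast
    then show ?thesis using p(3)[OF C] m by blast
  qed
  have att_ex: "\<exists>D\<in>Q. attachable C D" if C: "C \<in> bad_chains n P" for C
  proof -
    obtain x where x: "is_top C x" "rank x < d 4 n" using C unfolding bad_chains_def by blast
    then have "incr_hd x \<in> starts Q" using bad badP[OF C] unfolding ends_def by blast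
    then show ?thesis using x unfolding starts_def attachable_def by blast
  qed
  have W_cases: "(\<exists>C\<in>P - bad_chains n P. X = {x \<in> C. rank x \<le> d 4 n}) \<or>
      (\<exists>C\<in>bad_chains n P. \<exists>D\<in>Q. attachable C D \<and> X = C \<union> D) \<or>
      (X \<in> Q \<and> (\<forall>C\<in>bad_chains n P. \<not> attachable C X))" if "X \<in> W" for X
    using that unfolding W_def good_chains_def truncate_def by blast
  have good: "\<exists>b t. is_bottom C b \<and> saturated_chain b t {x \<in> C. rank x \<le> d 4 n} \<and> rank t = d 4 n"
    if C: "C \<in> P - bad_chains n P" for C
  proof -
    obtain b t where bt: "saturated_chain b t C" using p(4) C by blast
    have b: "rank b \<le> d 4 n" using sP saturated_chainD(2)[OF bt] C unfolding starts_def by blast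
    have t: "d 4 n \<le> rank t" using bad_iff[OF _ saturated_chainD(3)[OF bt]] C by auto
    show ?thesis using saturated_chain_truncate[OF bt b t] saturated_chainD(2)[OF bt] by blast
  qed
  have attd: "\<exists>b t. is_bottom C b \<and> saturated_chain b t (C \<union> D) \<and> rank t = d 4 n"
    if C: "C \<in> bad_chains n P" and D: "D \<in> Q" and a: "attachable C D" for C D
  proof -
    obtain b t where bt: "saturated_chain b t C" using p(4)[OF badP[OF C]] by blast
    obtain b' t' where bt': "saturated_chain b' t' D" using q(4)[OF D] by blast
    have tA: "t \<in> A" using saturated_chainD(5)[OF bt] p(1)[OF badP[OF C]] by blast
    have "b' = incr_hd t" using a is_top_unique[OF saturated_chainD(3)[OF bt]]
        is_bottom_unique[OF saturated_chainD(2)[OF bt']] unfolding attachable_def by blast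
    then have "saturated_chain b t' (C \<union> D)"
      using saturated_chain_Un[OF bt bt'] incr[OF tA] by simp
    moreover have "rank t' = d 4 n" using eQ saturated_chainD(3)[OF bt'] D unfolding ends_def by blast
    ultimately show ?thesis using saturated_chainD(2)[OF bt] by blast
  qed
  have rest: "\<exists>b t. saturated_chain b t D \<and> rank t = d 4 n" if D: "D \<in> Q" for D
    using q(4)[OF D] eQ saturated_chainD(3) D unfolding ends_def by blast
  have goodW: "{x \<in> C. rank x \<le> d 4 n} \<in> W" if C: "C \<in> P - bad_chains n P" for C
  proof -
    have "{x \<in> C. rank x \<le> d 4 n} \<noteq> {}" using good[OF C] saturated_chainD(4) by blast
    moreover have "{x \<in> C. rank x \<le> d 4 n} \<in> (\<lambda>C. {x \<in> C. rank x \<le> d 4 n}) ` (P - bad_chains n P)"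
      using C by (rule imageI)
    ultimately show ?thesis unfolding W_def good_chains_def truncate_def by simp
  qed
  have attW: "C \<union> D \<in> W" if "C \<in> bad_chains n P" "D \<in> Q" "attachable C D" for C D
    using that unfolding W_def by blast
  have lowB: "rank x \<le> d 4 n" if C: "C \<in> bad_chains n P" and "x \<in> C" for x C
  proof -
    obtain t where "is_top C t" "rank t < d 4 n" using C unfolding bad_chains_def by blast
    then show ?thesis using rank_mono[of x t] that unfolding is_top_def by fastforce
  qed
  have W_sat: "\<exists>b t. saturated_chain b t X \<and> rank t = d 4 n" if X: "X \<in> W" for X
    using W_cases[OF X] good attd rest by blast
  have "saturated_partition ({x \<in> A. rank x \<le> d 4 n} \<union> B) W"
  proof (rule saturated_partitionI)
    fix X assume X: "X \<in> W"
    show "X \<subseteq> {x \<in> A. rank x \<le> d 4 n} \<union> B"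
      using W_cases[OF X] p(1) q(1) lowB badP by blast
    show "\<exists>b t. saturated_chain b t X"
      using W_sat[OF X] by blast
  next
    fix x assume x: "x \<in> {x \<in> A. rank x \<le> d 4 n} \<union> B"
    show "\<exists>X\<in>W. x \<in> X"
    proof (cases "x \<in> B")
      case True
      then obtain D where D: "D \<in> Q" "x \<in> D" using q(2) by blast
      show ?thesis
      proof (cases "\<exists>C\<in>bad_chains n P. attachable C D")
        case True
        then obtain C where "C \<in> bad_chains n P" "attachable C D" by blast
        then have "C \<union> D \<in> W" using attW D by blast
        then show ?thesis using D by blast
      next
        case False
        then have "D \<in> W" using D unfolding W_def by blast
        then show ?thesis using D by blast
      qed
    next
      case False
      then obtain C where C: "C \<in> P" "x \<in> C" "rank x \<le> d 4 n" using p(2) x by blast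
      show ?thesis
      proof (cases "C \<in> bad_chains n P")
        case True
        then obtain D where "D \<in> Q" "attachable C D" using att_ex by blast
        then have "C \<union> D \<in> W" using attW True by blast
        then show ?thesis using C by blast
      next
        case False
        then have "{x \<in> C. rank x \<le> d 4 n} \<in> W" using goodW C by blast
        moreover have "x \<in> {x \<in> C. rank x \<le> d 4 n}" using C by simp
        ultimately show ?thesis by (rule bexI[rotated])
      qed
    qed
  next
    fix X Y x assume X: "X \<in> W" and Y: "Y \<in> W" and x: "x \<in> X" "x \<in> Y"
    \<comment> \<open>Any member of \<open>W\<close> through a point of \<open>A\<close>, or of \<open>B\<close>, is a function of the old chain
      through that point; two members sharing a point therefore coincide.\<close>
    have low: "X = (if C \<in> bad_chains n P then C \<union> (THE D. D \<in> Q \<and> attachable C D)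
        else {x \<in> C. rank x \<le> d 4 n})" if X: "X \<in> W" "x \<in> X" and C: "C \<in> P" "x \<in> C" for X C
    proof -
      consider (g) C' where "C' \<in> P" "C' \<notin> bad_chains n P" "X = {x \<in> C'. rank x \<le> d 4 n}"
        | (a) C' D where "C' \<in> bad_chains n P" "D \<in> Q" "attachable C' D" "X = C' \<union> D"
        | (r) "X \<in> Q" using W_cases[OF X(1)] by blast
      then show ?thesis
      proof cases
        case g
        then have "x \<in> C'" using X(2) by simp
        then have "C' = C" using p(3)[OF g(1) C(1)] C(2) by simp
        then show ?thesis using g by simp
      next
        case a
        have "x \<in> C'" using X(2) a(4) PQ[OF C(1) a(2) C(2)] by simp
        then have "C' = C" using p(3)[OF badP[OF a(1)] C(1)] C(2) by simp
        moreover have "(THE D. D \<in> Q \<and> attachable C' D) = D"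
        proof (rule the_equality)
          show "D' = D" if "D' \<in> Q \<and> attachable C' D'" for D'
            using that att_fun[of C' D' D] a(2,3) by simp
        qed (use a(2,3) in simp)
        ultimately show ?thesis using a by simp
      next
        case r
        then show ?thesis using PQ[OF C(1) r C(2)] X(2) by simp
      qed
    qed
    have high: "X = (if \<exists>C\<in>bad_chains n P. attachable C D
        then (THE C. C \<in> bad_chains n P \<and> attachable C D) \<union> D else D)"
      if X: "X \<in> W" "x \<in> X" and D: "D \<in> Q" "x \<in> D" for X D
    proof -
      consider (g) C' where "C' \<in> P" "X \<subseteq> C'"
        | (a) C D' where "C \<in> bad_chains n P" "D' \<in> Q" "attachable C D'" "X = C \<union> D'"
        | (r) "X \<in> Q" "\<forall>C\<in>bad_chains n P. \<not> attachable C X" using W_cases[OF X(1)] by blast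
      then show ?thesis
      proof cases
        case g
        then have "x \<in> C'" using X(2) by auto
        then show ?thesis using PQ[OF g(1) D(1)] D(2) by simp
      next
        case a
        have "x \<notin> C" using PQ[OF badP[OF a(1)] D(1)] D(2) by auto
        then have "x \<in> D'" using X(2) a(4) by simp
        then have "D' = D" using q(3)[OF a(2) D(1)] D(2) by simp
        moreover have "(THE C. C \<in> bad_chains n P \<and> attachable C D') = C"
        proof (rule the_equality)
          show "C' = C" if "C' \<in> bad_chains n P \<and> attachable C' D'" for C'
            using that att_inj[of C' D' C] a(1,3) badP by simp
        qed (use a(1,3) in simp)
        ultimately show ?thesis using a by auto
      next
        case r
        have "X = D" using q(3)[OF r(1) D(1) X(2) D(2)] .
        then show ?thesis using r by auto
      qed
    qed
    have "x \<in> A \<or> x \<in> B" using W_cases[OF X] x(1) p(1) q(1) badP by blast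
    then show "X = Y"
    proof
      assume "x \<in> A"
      then obtain C where "C \<in> P" "x \<in> C" using p(2) by blast
      then show ?thesis using low[OF X x(1)] low[OF Y x(2)] by simp
    next
      assume "x \<in> B"
      then obtain D where "D \<in> Q" "x \<in> D" using q(2) by blast
      then show ?thesis using high[OF X x(1)] high[OF Y x(2)] by simp
    qed
  qed
  moreover have "\<forall>x\<in>ends W. rank x = d 4 n"
  proof
    fix x assume "x \<in> ends W"
    then obtain X where X: "X \<in> W" "is_top X x" unfolding ends_def by blast
    then obtain b t where t: "saturated_chain b t X" "rank t = d 4 n" using W_sat by blast
    then show "rank x = d 4 n" using is_top_unique[OF X(2) saturated_chainD(3)[OF t(1)]] by simp
  qed
  moreover have "starts W = starts P \<union> (starts Q - incr_hd ` {x \<in> ends P. rank x < d 4 n})"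
  proof (intro equalityI subsetI)
    fix x assume "x \<in> starts W"
    then obtain X where X: "X \<in> W" "is_bottom X x" unfolding starts_def by blast
    consider (g) C where "C \<in> P - bad_chains n P" "X = {x \<in> C. rank x \<le> d 4 n}"
      | (a) C D where "C \<in> bad_chains n P" "D \<in> Q" "attachable C D" "X = C \<union> D"
      | (r) "X \<in> Q" "\<forall>C\<in>bad_chains n P. \<not> attachable C X" using W_cases[OF X(1)] by blast
    then show "x \<in> starts P \<union> (starts Q - incr_hd ` {x \<in> ends P. rank x < d 4 n})"
    proof cases
      case g
      then have "is_bottom C x"
        using good[OF g(1)] X(2) is_bottom_unique saturated_chainD(2) by blast
      then show ?thesis using g unfolding starts_def by blast
    next
      case a
      then have "is_bottom C x"
        using attd[OF a(1-3)] X(2) is_bottom_unique saturated_chainD(2) by blast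
      then show ?thesis using badP[OF a(1)] unfolding starts_def by blast
    next
      case r
      have "x \<noteq> incr_hd y" if "y \<in> ends P" "rank y < d 4 n" for y
        using that r X unfolding ends_def bad_chains_def attachable_def by blast
      then show ?thesis using r(1) X(2) unfolding starts_def by blast
    qed
  next
    fix x assume "x \<in> starts P \<union> (starts Q - incr_hd ` {x \<in> ends P. rank x < d 4 n})"
    then show "x \<in> starts W"
    proof
      assume "x \<in> starts P"
      then obtain C where C: "C \<in> P" "is_bottom C x" unfolding starts_def by blast
      show ?thesis
      proof (cases "C \<in> bad_chains n P")
        case True
        then obtain D where D: "D \<in> Q" "attachable C D" using att_ex by blast
        have "is_bottom (C \<union> D) x"
          using attd[OF True D] is_bottom_unique[OF C(2)] saturated_chainD(2) by blast
        then show ?thesis using attW[OF True D] unfolding starts_def by blast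
      next
        case False
        then have g: "C \<in> P - bad_chains n P" using C by blast
        have "is_bottom {x \<in> C. rank x \<le> d 4 n} x"
          using good[OF g] is_bottom_unique[OF C(2)] saturated_chainD(2) by blast
        then show ?thesis using goodW[OF g] unfolding starts_def by blast
      qed
    next
      assume x: "x \<in> starts Q - incr_hd ` {x \<in> ends P. rank x < d 4 n}"
      then obtain D where D: "D \<in> Q" "is_bottom D x" unfolding starts_def by blast
      have "\<not> attachable C D" if C: "C \<in> bad_chains n P" for C
      proof
        assume "attachable C D"
        then obtain t where t: "is_top C t" "x = incr_hd t"
          unfolding attachable_def using is_bottom_unique[OF D(2)] by blast
        then have "t \<in> ends P" "rank t < d 4 n"
          using C badP[OF C] bad_iff[OF badP[OF C] t(1)] unfolding ends_def by auto
        then show False using x t(2) by blast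
      qed
      then have "D \<in> W" using D unfolding W_def by blast
      then show ?thesis using D(2) unfolding starts_def by blast
    qed
  qed
  ultimately show ?thesis using step by blast
qed

section \<open>The starting partitions\<close>

lemma L4_iff: "x \<in> L 4 n \<longleftrightarrow> (\<exists>a b c e. x = [a, b, c, e] \<and> a \<le> n \<and> b \<le> a \<and> c \<le> b \<and> e \<le> c)"
  unfolding L_def by (auto simp: length_Suc_conv numeral_eq_Suc)

lemma LU4_split:
  assumes "1 \<le> n"
  shows "LU 4 n = {x \<in> L 4 (n - 1). rank x \<le> d 4 n} \<union> (#) n ` {w \<in> partitions3. rank w \<le> n}"
proof (intro equalityI subsetI)
  fix x assume "x \<in> LU 4 n"
  then obtain a b c e where x: "x = [a, b, c, e]" "a \<le> n" "b \<le> a" "c \<le> b" "e \<le> c" "rank x \<le> d 4 n"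
    unfolding LU_def L4_iff by blast
  show "x \<in> {x \<in> L 4 (n - 1). rank x \<le> d 4 n} \<union> (#) n ` {w \<in> partitions3. rank w \<le> n}"
  proof (cases "a = n")
    case True
    then have "[b, c, e] \<in> {w \<in> partitions3. rank w \<le> n}"
      using x by (simp add: partitions3_iff d4)
    then show ?thesis using x True by blast
  next
    case False
    then have "a \<le> n - 1" using x by simp
    then show ?thesis using x L4_iff by blast
  qed
next
  fix x assume "x \<in> {x \<in> L 4 (n - 1). rank x \<le> d 4 n} \<union> (#) n ` {w \<in> partitions3. rank w \<le> n}"
  then show "x \<in> LU 4 n"
    using assms unfolding LU_def L4_iff d4 by (auto elim!: partitions3E)
qed

lemma LU4_disjoint: "1 \<le> n \<Longrightarrow> L 4 (n - 1) \<inter> (#) n ` X = {}"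
  unfolding L4_iff by (auto simp: L4_iff)

text \<open>
  The rank condition forces \<open>s \<le> 1\<close>, and \<open>s \<noteq> 1\<close> then gives \<open>s = 0\<close> and \<open>6k + l = n - 1\<close>. Hence
  the last entry of the dual vanishes, as it must for the bottom of a candidate.
\<close>

lemma bad_end_iff:
  assumes "1 \<le> n"
  shows "(\<exists>x\<in>dual (n - 1) ` S4 (n - 1). rank x < d 4 n \<and> y = incr_hd x) \<longleftrightarrow>
    (\<exists>k l. y = [n, 4 * k + l, 2 * k, 0] \<and> l \<noteq> 1 \<and> 6 * k + l = n - 1)"
proof
  assume "\<exists>x\<in>dual (n - 1) ` S4 (n - 1). rank x < d 4 n \<and> y = incr_hd x"
  then obtain k s l where h: "s \<noteq> 1" "l \<noteq> 1" "6 * k + s + l \<le> n - 1"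
    "rank (dual (n - 1) [6 * k + s + l, 4 * k + l, 2 * k, 0]) < d 4 n"
    "y = incr_hd (dual (n - 1) [6 * k + s + l, 4 * k + l, 2 * k, 0])"
    unfolding S4_def by auto
  from h(1,3,4) assms have "s = 0" "6 * k + l = n - 1" by (auto simp: dual_def d4)
  moreover from this h(5) assms have "y = [n, 4 * k + l, 2 * k, 0]" by (auto simp: dual_def incr_hd_def)
  ultimately show "\<exists>k l. y = [n, 4 * k + l, 2 * k, 0] \<and> l \<noteq> 1 \<and> 6 * k + l = n - 1" using h(2) by blast
next
  assume "\<exists>k l. y = [n, 4 * k + l, 2 * k, 0] \<and> l \<noteq> 1 \<and> 6 * k + l = n - 1"
  then obtain k l where h: "y = [n, 4 * k + l, 2 * k, 0]" "l \<noteq> 1" "6 * k + l = n - 1" by blast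
  let ?x = "[6 * k + 0 + l, 4 * k + l, 2 * k, 0]"
  have "(0 :: nat) \<noteq> 1 \<and> l \<noteq> 1 \<and> 6 * k + 0 + l \<le> n - 1" using h by auto
  then have "?x \<in> S4 (n - 1)" unfolding S4_def by blast
  moreover have "rank (dual (n - 1) ?x) < d 4 n" "y = incr_hd (dual (n - 1) ?x)"
    using h assms by (auto simp: dual_def d4 incr_hd_def)
  ultimately show "\<exists>x\<in>dual (n - 1) ` S4 (n - 1). rank x < d 4 n \<and> y = incr_hd x" by blast
qed

lemma bad_end_attachable:
  assumes "1 \<le> n" "x \<in> dual (n - 1) ` S4 (n - 1)" "rank x < d 4 n"
  shows "incr_hd x \<in> (#) n ` {m \<in> phi_minimal. rank m \<le> n}"
proof -
  obtain k l where "incr_hd x = [n, 4 * k + l, 2 * k, 0]" "l \<noteq> 1" "6 * k + l = n - 1"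
    using bad_end_iff[OF assms(1)] assms(2,3) by blast
  moreover from this have "[4 * k + l, 2 * k, 0] \<in> {m \<in> phi_minimal. rank m \<le> n}"
    unfolding phi_minimal_def by auto
  ultimately show ?thesis by simp
qed

text \<open>
  The elements of \<open>S4 n\<close> with first entry \<open>n\<close> have \<open>s = n - 6k - l\<close>; the excluded value \<open>s = 1\<close>
  accounts for the candidates attached to bad chains.
\<close>

lemma S4_step:
  assumes "1 \<le> n"
  shows "S4 n = S4 (n - 1) \<union> ((#) n ` {m \<in> phi_minimal. rank m \<le> n} -
    incr_hd ` {x \<in> dual (n - 1) ` S4 (n - 1). rank x < d 4 n})"
proof -
  have bad: "incr_hd ` {x \<in> dual (n - 1) ` S4 (n - 1). rank x < d 4 n} =
      {[n, 4 * k + l, 2 * k, 0] | k l. l \<noteq> 1 \<and> 6 * k + l = n - 1}"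
    using bad_end_iff[OF assms] by blast
  have cand: "(#) n ` {m \<in> phi_minimal. rank m \<le> n} =
      {[n, 4 * k + l, 2 * k, 0] | k l. l \<noteq> 1 \<and> 6 * k + l \<le> n}"
    unfolding phi_minimal_def by (auto simp: image_iff)
  have "(#) n ` {m \<in> phi_minimal. rank m \<le> n} -
      incr_hd ` {x \<in> dual (n - 1) ` S4 (n - 1). rank x < d 4 n} =
      {[n, 4 * k + l, 2 * k, 0] | k l. l \<noteq> 1 \<and> 6 * k + l \<le> n \<and> 6 * k + l \<noteq> n - 1}"
    unfolding bad cand by auto
  also have "\<dots> = {[6 * k + s + l, 4 * k + l, 2 * k, 0] | s l k. s \<noteq> 1 \<and> l \<noteq> 1 \<and> 6 * k + s + l = n}"
  proof (intro equalityI subsetI)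
    fix x assume "x \<in> {[n, 4 * k + l, 2 * k, 0] | k l. l \<noteq> 1 \<and> 6 * k + l \<le> n \<and> 6 * k + l \<noteq> n - 1}"
    then obtain k l where x: "x = [n, 4 * k + l, 2 * k, 0]" "l \<noteq> 1" "6 * k + l \<le> n" "6 * k + l \<noteq> n - 1"
      by blast
    define s where "s = n - (6 * k + l)"
    have "s \<noteq> 1" "6 * k + s + l = n" unfolding s_def using x by auto
    then show "x \<in> {[6 * k + s + l, 4 * k + l, 2 * k, 0] | s l k. s \<noteq> 1 \<and> l \<noteq> 1 \<and> 6 * k + s + l = n}"
      using x(1,2) by blast
  next
    fix x assume "x \<in> {[6 * k + s + l, 4 * k + l, 2 * k, 0] | s l k. s \<noteq> 1 \<and> l \<noteq> 1 \<and> 6 * k + s + l = n}"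
    then obtain s l k where x: "x = [6 * k + s + l, 4 * k + l, 2 * k, 0]" "s \<noteq> 1" "l \<noteq> 1" "6 * k + s + l = n"
      by blast
    then have "x = [n, 4 * k + l, 2 * k, 0]" "6 * k + l \<le> n" "6 * k + l \<noteq> n - 1"
      using assms by auto
    then show "x \<in> {[n, 4 * k + l, 2 * k, 0] | k l. l \<noteq> 1 \<and> 6 * k + l \<le> n \<and> 6 * k + l \<noteq> n - 1}"
      using x(3) by blast
  qed
  also have "S4 (n - 1) \<union> \<dots> = S4 n"
  proof -
    have "m \<le> n \<longleftrightarrow> m \<le> n - 1 \<or> m = n" for m using assms by auto
    then show ?thesis unfolding S4_def by blast
  qed
  finally show ?thesis by simp
qed

section \<open>The recursion\<close>

lemma L41_truncated: "truncate (d 4 1) {L 4 1} = {{[0, 0, 0, 0], [1, 0, 0, 0], [1, 1, 0, 0]}}"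
  and LU41: "LU 4 1 = {[0, 0, 0, 0], [1, 0, 0, 0], [1, 1, 0, 0]}"
proof -
  show LU: "LU 4 1 = {[0, 0, 0, 0], [1, 0, 0, 0], [1, 1, 0, 0]}"
  proof (intro equalityI subsetI)
    fix x assume "x \<in> LU 4 1"
    then obtain a b c e where x: "x = [a, b, c, e]" "a \<le> 1" "b \<le> a" "c \<le> b" "e \<le> c" "a + b + c + e \<le> 2"
      unfolding LU_def L4_iff d4 by auto
    then have "c = 0" "e = 0" "(a = 0 \<and> b = 0) \<or> (a = 1 \<and> b = 0) \<or> (a = 1 \<and> b = 1)" by auto
    then show "x \<in> {[0, 0, 0, 0], [1, 0, 0, 0], [1, 1, 0, 0]}" using x(1) by auto
  qed (auto simp: LU_def L4_iff d4)
  have "{x \<in> L 4 1. rank x \<le> d 4 1} = LU 4 1" unfolding LU_def ..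
  then show "truncate (d 4 1) {L 4 1} = {{[0, 0, 0, 0], [1, 0, 0, 0], [1, 1, 0, 0]}}"
    unfolding truncate_def LU by auto
qed

lemma saturated_chain_L41:
  "saturated_chain [0, 0, 0, 0] [1, 1, 0, 0] {[0, 0, 0, 0], [1, 0, 0, 0], [1, 1, 0, 0]}"
proof -
  have "{0..2} = {0, 1, 2 :: nat}" by auto
  then show ?thesis
    unfolding saturated_chain_def chain_def is_bottom_def is_top_def by auto
qed

lemma S4_1: "S4 1 = {[0, 0, 0, 0]}"
proof -
  have "s \<noteq> 1 \<and> l \<noteq> 1 \<and> 6 * k + s + l \<le> 1 \<longleftrightarrow> s = 0 \<and> l = 0 \<and> k = 0" for s l k :: nat by auto
  then show ?thesis unfolding S4_def by simp
qed

lemma RecUD_saturated_partition: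
  assumes "1 \<le> n"
  shows "\<exists>U. RecUD n = Some U \<and> saturated_partition (LU 4 n) U \<and>
    (\<forall>x\<in>ends U. rank x = d 4 n) \<and> starts U = S4 n"
  using assms
proof (induction n rule: nat_induct_at_least)
  case base
  let ?C = "{[0, 0, 0, 0], [1, 0, 0, 0], [1, 1, 0, 0 :: nat]}"
  note C = saturated_chain_L41
  have "RecUD 1 = Some {?C}" using L41_truncated by simp
  moreover have "saturated_partition (LU 4 1) {?C}"
    unfolding LU41 by (rule saturated_partitionI) (use C in auto)
  moreover have "rank x = d 4 1" if "x \<in> ends {?C}" for x
  proof -
    have "x = [1, 1, 0, 0]" using that saturated_chainD(3)[OF C] is_top_unique unfolding ends_def by blast
    then show ?thesis by (simp add: d4)
  qed
  moreover have "starts {?C} = S4 1"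
    unfolding S4_1 starts_def using saturated_chainD(2)[OF C] is_bottom_unique by auto
  ultimately show ?case by blast
next
  case (Suc n)
  then obtain U where U: "RecUD n = Some U" "saturated_partition (LU 4 n) U"
    "\<And>x. x \<in> ends U \<Longrightarrow> rank x = d 4 n" "starts U = S4 n" by blast
  note K = knead_saturated[OF U(2,3), simplified U(4)]
  note Q = candidates_saturated_partition[where n = "Suc n"]
  have r: "rank x \<le> d 4 (Suc n)" if x: "x \<in> S4 n" for x
  proof -
    have "x \<in> LU 4 n" using x starts_subset[OF U(2)] U(4) by blast
    then show ?thesis unfolding LU_def d4 by auto
  qed
  have "\<exists>W. RecUD_step (Suc n) U (UD3 (Suc n)) = Some W \<and>
    saturated_partition ({x \<in> L 4 n. rank x \<le> d 4 (Suc n)} \<union> (#) (Suc n) ` {w \<in> partitions3. rank w \<le> Suc n}) W \<and>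
    (\<forall>x\<in>ends W. rank x = d 4 (Suc n)) \<and>
    starts W = starts (knead (Suc n - 1) U) \<union> (starts (candidates (Suc n) (UD3 (Suc n))) -
      incr_hd ` {x \<in> ends (knead (Suc n - 1) U). rank x < d 4 (Suc n)})"
  proof (rule RecUD_step_saturated_partition)
    show "saturated_partition (L 4 n) (knead (Suc n - 1) U)" using K(1) by simp
    show "L 4 n \<inter> (#) (Suc n) ` {w \<in> partitions3. rank w \<le> Suc n} = {}"
      using LU4_disjoint[of "Suc n"] by simp
    show "[] \<notin> L 4 n" unfolding L4_iff by simp
    show "rank x \<le> d 4 (Suc n)" if "x \<in> starts (knead (Suc n - 1) U)" for x
      using that r K(2) by simp
    show "incr_hd x \<in> starts (candidates (Suc n) (UD3 (Suc n)))"
      if "x \<in> ends (knead (Suc n - 1) U)" "rank x < d 4 (Suc n)" for x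
      unfolding Q(2) using that K(3) bad_end_attachable[of "Suc n" x] by simp
  qed (use Q in auto)
  moreover have "RecUD (Suc n) = RecUD_step (Suc n) U (UD3 (Suc n))"
    using U(1) Suc.hyps by (cases n) auto
  ultimately show ?case
    using LU4_split[of "Suc n"] S4_step[of "Suc n"] K(2,3) Q(2) by simp
qed

theorem theorem24:
  fixes n :: nat
  assumes "1 \<le> n"
  shows "\<exists>U. RecUD n = Some U \<and> U_decomposition 4 n U \<and>
             Sperner_decomposition 4 n (knead n U) \<and> starts (knead n U) = S4 n"
proof -
  obtain U where U: "RecUD n = Some U" "saturated_partition (LU 4 n) U"
    "\<And>x. x \<in> ends U \<Longrightarrow> rank x = d 4 n" "starts U = S4 n"
    using RecUD_saturated_partition[OF assms] by blast
  have K: "saturated_partition (L 4 n) (knead n U)" "starts (knead n U) = S4 n"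
    "ends (knead n U) = dual n ` S4 n"
    using knead_saturated[OF U(2,3)] U(4) by simp_all
  have S4: "x \<in> L 4 n \<and> rank x \<le> 2 * n" if x: "x \<in> S4 n" for x
  proof -
    have "x \<in> LU 4 n" using x starts_subset[OF U(2)] U(4) by blast
    then show ?thesis unfolding LU_def d4 by auto
  qed
  have "4 * n \<le> 2 * rank (dual n x)" if "x \<in> S4 n" for x
    using S4[OF that] rank_dual[of x 4 n] by auto
  then have "Sperner_decomposition 4 n (knead n U)"
    using saturated_partition_Sperner_decomposition[OF K(1)] K(2,3) S4 by fastforce
  then show ?thesis
    using U K saturated_partition_U_decomposition[OF U(2,3)] by blast
qed

end
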